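(* Assume Dickson's Conjecture. Then the answer to the following question is NO: "If $\omega = s + \omega_1 \cdot \omega_2$ with $s$ limited and $\omega_1, \omega_2$ unlimited, is then also $\omega = s' + \omega'_1 \cdot \omega'_2$ with $s'$ limited and $\omega'_1 \sim \omega'_2$?" That is, there exist an elementary extension $(Z', <, +, \times, 0, 1)$ of $(\mathbb{Z}, <, +, \times, 0, 1)$ and an element $\omega \in Z'$ such that $\omega = s + \omega_1 \cdot \omega_2$ for some limited $s \in Z'$ and some unlimited $\omega_1, \omega_2 \in Z'$, but there are no limited $s' \in Z'$ and $\omega'_1, \omega'_2 \in Z'$ with $\omega'_1 \sim \omega'_2$ and $\omega = s' + \omega'_1 \cdot \omega'_2$.
   Context: Dickson's Conjecture is the following statement: Let $\ell \ge 1$ and $f_i(x) = c_i + b_i x$ with $c_i, b_i$ integers, $b_i \ge 1$ ($i = 1, \ldots, \ell$). If there is no integer $n > 1$ that divides $\prod_{i=1}^{\ell} f_i(k)$ for every integer $k$, then there exist infinitely many natural numbers $m$ such that all the numbers $f_1(m), \ldots, f_\ell(m)$ are prime. For an elementary extension $Z'$ of $\mathbb{Z}$, an element of $Z'$ is limited if its absolute value is bounded by an element of $\mathbb{Z}$ (equivalently, it belongs to $\mathbb{Z}$), and unlimited otherwise. For $\omega_1, \omega_2 \in Z'$, $\omega_1 \sim \omega_2$ means that there is a limited $k \in \mathbb{N}$ such that $|\omega_1| \le k \cdot |\omega_2|$ and $|\omega_2| \le k \cdot |\omega_1|$. *)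

theory Defs
  imports "HOL-Computational_Algebra.Primes" "HOL-Algebra.Ring"
begin

definition dickson_conjecture :: bool where
  "dickson_conjecture \<longleftrightarrow>
    (\<forall>(l::nat) (c::nat \<Rightarrow> int) (b::nat \<Rightarrow> int).
       l \<ge> 1 \<longrightarrow> (\<forall>i\<in>{1..l}. b i \<ge> 1) \<longrightarrow>
       \<not> (\<exists>n::int. n > 1 \<and> (\<forall>k::int. n dvd (\<Prod>i\<in>{1..l}. c i + b i * k))) \<longrightarrow>
       infinite {m::nat. \<forall>i\<in>{1..l}. prime (c i + b i * int m)})"

record 'a ordered_ring_struct = "'a ring" +
  lt :: "'a \<Rightarrow> 'a \<Rightarrow> bool" (infix "\<prec>\<index>" 50)

(* Well-formedness only (the carrier is closed under the operations); no algebraic laws. *)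
definition is_structure :: "('a, 'b) ordered_ring_struct_scheme \<Rightarrow> bool" where
  "is_structure M \<longleftrightarrow>
     \<zero>\<^bsub>M\<^esub> \<in> carrier M \<and> \<one>\<^bsub>M\<^esub> \<in> carrier M \<and>
     (\<forall>x\<in>carrier M. \<forall>y\<in>carrier M. x \<oplus>\<^bsub>M\<^esub> y \<in> carrier M \<and> x \<otimes>\<^bsub>M\<^esub> y \<in> carrier M)"

definition int_struct :: "int ordered_ring_struct" where
  "int_struct = \<lparr>carrier = UNIV, mult = (*), one = 1, zero = 0, add = (+), lt = (<)\<rparr>"

datatype tm = Var nat | Zero | One | Plus tm tm | Times tm tm

datatype fm = Eq tm tm | Less tm tm | Neg fm | And fm fm | All nat fm

primrec tm_val :: "('a, 'b) ordered_ring_struct_scheme \<Rightarrow> (nat \<Rightarrow> 'a) \<Rightarrow> tm \<Rightarrow> 'a" where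
  "tm_val M e (Var n) = e n"
| "tm_val M e Zero = \<zero>\<^bsub>M\<^esub>"
| "tm_val M e One = \<one>\<^bsub>M\<^esub>"
| "tm_val M e (Plus s t) = tm_val M e s \<oplus>\<^bsub>M\<^esub> tm_val M e t"
| "tm_val M e (Times s t) = tm_val M e s \<otimes>\<^bsub>M\<^esub> tm_val M e t"

primrec sat :: "('a, 'b) ordered_ring_struct_scheme \<Rightarrow> (nat \<Rightarrow> 'a) \<Rightarrow> fm \<Rightarrow> bool" where
  "sat M e (Eq s t) \<longleftrightarrow> tm_val M e s = tm_val M e t"
| "sat M e (Less s t) \<longleftrightarrow> tm_val M e s \<prec>\<^bsub>M\<^esub> tm_val M e t"
| "sat M e (Neg p) \<longleftrightarrow> \<not> sat M e p"
| "sat M e (And p q) \<longleftrightarrow> sat M e p \<and> sat M e q"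
| "sat M e (All n p) \<longleftrightarrow> (\<forall>x\<in>carrier M. sat M (e(n := x)) p)"

definition elementary_embedding ::
  "('a, 'b) ordered_ring_struct_scheme \<Rightarrow> ('c, 'd) ordered_ring_struct_scheme \<Rightarrow> ('a \<Rightarrow> 'c) \<Rightarrow> bool" where
  "elementary_embedding M N j \<longleftrightarrow>
     j ` carrier M \<subseteq> carrier N \<and>
     (\<forall>p e. range e \<subseteq> carrier M \<longrightarrow> (sat M e p \<longleftrightarrow> sat N (j \<circ> e) p))"

(* As usual, the integers are identified with their image under the embedding j. *)
definition elementary_extension_of_int ::
  "('a, 'b) ordered_ring_struct_scheme \<Rightarrow> (int \<Rightarrow> 'a) \<Rightarrow> bool" where
  "elementary_extension_of_int Z' j \<longleftrightarrow> is_structure Z' \<and> elementary_embedding int_struct Z' j"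

definition leq :: "('a, 'b) ordered_ring_struct_scheme \<Rightarrow> 'a \<Rightarrow> 'a \<Rightarrow> bool" (infix "\<preceq>\<index>" 50) where
  "x \<preceq>\<^bsub>M\<^esub> y \<longleftrightarrow> x \<prec>\<^bsub>M\<^esub> y \<or> x = y"

definition absval :: "('a, 'b) ordered_ring_struct_scheme \<Rightarrow> 'a \<Rightarrow> 'a" where
  "absval M x = (if x \<prec>\<^bsub>M\<^esub> \<zero>\<^bsub>M\<^esub> then \<ominus>\<^bsub>M\<^esub> x else x)"

definition limited :: "('a, 'b) ordered_ring_struct_scheme \<Rightarrow> (int \<Rightarrow> 'a) \<Rightarrow> 'a \<Rightarrow> bool" where
  "limited Z' j x \<longleftrightarrow> x \<in> carrier Z' \<and> (\<exists>n. absval Z' x \<preceq>\<^bsub>Z'\<^esub> j n)"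

definition unlimited :: "('a, 'b) ordered_ring_struct_scheme \<Rightarrow> (int \<Rightarrow> 'a) \<Rightarrow> 'a \<Rightarrow> bool" where
  "unlimited Z' j x \<longleftrightarrow> x \<in> carrier Z' \<and> \<not> limited Z' j x"

definition same_magnitude ::
  "('a, 'b) ordered_ring_struct_scheme \<Rightarrow> (int \<Rightarrow> 'a) \<Rightarrow> 'a \<Rightarrow> 'a \<Rightarrow> bool" where
  "same_magnitude Z' j x y \<longleftrightarrow>
     (\<exists>k. limited Z' j k \<and> \<zero>\<^bsub>Z'\<^esub> \<preceq>\<^bsub>Z'\<^esub> k \<and>
          absval Z' x \<preceq>\<^bsub>Z'\<^esub> k \<otimes>\<^bsub>Z'\<^esub> absval Z' y \<and>
          absval Z' y \<preceq>\<^bsub>Z'\<^esub> k \<otimes>\<^bsub>Z'\<^esub> absval Z' x)"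

(* HOL cannot quantify existentially over types, so an extension has to be sought on a fixed
   ground type. This one contains the carrier of every ultrapower of the integers over a filter
   on nat, whose elements are equivalence classes of integer sequences. *)
type_synonym ext_elem = "(nat \<Rightarrow> int) set"

end

theory Submission
  imports Defs
begin

text \<open>
  For a bound \<open>N\<close> put \<open>L = ((2N + 1)!)\<^sup>2\<close>. By Dickson's Conjecture there are arbitrarily large \<open>m\<close> for
  which \<open>m\<close> and all \<open>(L / \<bar>s\<bar>) m - sgn s\<close> with \<open>0 < \<bar>s\<bar> \<le> N\<close> are prime; modulo a prime
  \<open>p > 2N + 1\<close>, none of these forms vanishes at \<open>m\<close> if \<open>L m\<close> is congruent to \<open>N + 1\<close>. Then
  \<open>w = L m\<close> is a product of two factors above \<open>N\<close>, whereas every \<open>w - s\<close> with \<open>\<bar>s\<bar> \<le> N\<close> is a huge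
  prime times a divisor of \<open>L\<close>, so its two factors in any factorization have a ratio above \<open>N\<close>. In an
  ultrapower of the integers over a nonprincipal ultrafilter, the class of the sequence of these
  \<open>w\<close>, one for each \<open>N\<close>, is the required \<open>\<omega>\<close>.
\<close>

section \<open>A consequence of Dickson's Conjecture\<close>

text \<open>The prime \<open>q\<close> divides one of the two factors, so that factor is at least
  \<open>q\<close> in absolute value, while the other divides \<open>d\<close> and is at most
  \<open>d\<close>. For nonnegative \<open>N\<close> the gap comes from \<open>q > N * d\<close>;
  for negative \<open>N\<close> the right-hand side is not positive.\<close>

lemma prime_multiple_factors_unbalanced:
  fixes q d x y N :: int
  assumes q: "prime q" and "q > N * d" and "d > 0" and xy: "x * y = d * q"
  shows "\<not> (\<bar>x\<bar> \<le> N * \<bar>y\<bar> \<and> \<bar>y\<bar> \<le> N * \<bar>x\<bar>)"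
proof -
  have unbalanced: "N * \<bar>v\<bar> < \<bar>u\<bar>" if "u * v = d * q" and "q dvd u" for u v
  proof -
    obtain u' where u': "u = q * u'" using \<open>q dvd u\<close> by blast
    have "q > 0" using q by (simp add: prime_gt_0_int)
    then have "u' * v = d" using that(1) u' by simp
    then have "v dvd d" "u' \<noteq> 0" using \<open>d > 0\<close> by auto
    have "\<bar>v\<bar> \<le> d" using \<open>v dvd d\<close> \<open>d > 0\<close> zdvd_imp_le[of "\<bar>v\<bar>" d] by simp
    have "q * 1 \<le> q * \<bar>u'\<bar>" using \<open>u' \<noteq> 0\<close> \<open>q > 0\<close> by (intro mult_left_mono) auto
    then have "q \<le> \<bar>u\<bar>" using u' \<open>q > 0\<close> by (simp add: abs_mult)
    show ?thesis
    proof (cases "N \<ge> 0")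
      case True
      then have "N * \<bar>v\<bar> \<le> N * d" using \<open>\<bar>v\<bar> \<le> d\<close> by (simp add: mult_left_mono)
      then show ?thesis using \<open>q > N * d\<close> \<open>q \<le> \<bar>u\<bar>\<close> by linarith
    next
      case False
      then have "N * \<bar>v\<bar> \<le> 0" by (simp add: mult_nonpos_nonneg)
      then show ?thesis using \<open>q \<le> \<bar>u\<bar>\<close> \<open>q > 0\<close> by linarith
    qed
  qed
  have "q dvd x * y" using xy by simp
  then have "q dvd x \<or> q dvd y" using q by (simp add: prime_dvd_mult_iff)
  moreover have "y * x = d * q" using xy by (simp add: mult.commute)
  ultimately show ?thesis using unbalanced xy by (meson not_less)
qed

text \<open>One parameter \<open>N\<close> governs the size of both factors, the range of the shifts
  and the imbalance of the factorizations. A sequence indexed by \<open>N\<close> therefore outgrows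
  every limited shift and every limited ratio at once.\<close>

lemma dickson_shifted_prime_multiples:
  fixes N :: nat
  assumes dickson_conjecture
  obtains L m :: int where "L > int N" "m > int N"
    "\<And>s. \<bar>s\<bar> \<le> int N \<Longrightarrow>
      \<exists>d q. 0 < d \<and> prime q \<and> q > int N * d \<and> L * m - s = d * q"
proof -
  define F :: int where "F = fact (2 * N + 1)"
  \<comment> \<open>Squaring leaves a factor \<open>F\<close> in \<open>L div \<bar>s\<bar>\<close>
    for \<open>0 < \<bar>s\<bar> \<le> N\<close>. Hence every prime dividing \<open>L\<close>
    divides the slope \<open>b s\<close> of each form with nonzero \<open>s\<close>.\<close>
  define L where "L = F * F"
  \<comment> \<open>With the value \<open>L\<close> at 0, the form for \<open>s = 0\<close> has
    slope 1 and constant term 0, so it is \<open>k\<close> itself.\<close>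
  define d where "d s = (if s = 0 then L else \<bar>s\<bar>)" for s :: int
  define b where "b s = L div d s" for s
  \<comment> \<open>Dickson's Conjecture numbers its forms from 1, whereas the shifts run from
    \<open>-N\<close> to \<open>N\<close>.\<close>
  define \<sigma> where "\<sigma> i = int i - 1 - int N" for i :: nat
  have "F > 0" by (simp add: F_def)
  then have "L > 0" by (simp add: L_def)
  have dvd_F: "k dvd F" if "1 \<le> k" "k \<le> 2 * int N + 1" for k
  proof -
    have "nat k dvd fact (2 * N + 1)" using that by (intro dvd_fact) auto
    then have "int (nat k) dvd int (fact (2 * N + 1))" by (rule of_nat_dvd_iff[THEN iffD2])
    moreover have "int (fact (2 * N + 1)) = F" unfolding F_def by (rule of_nat_fact)
    ultimately show ?thesis using that by simp
  qed
  have "2 * int N + 1 \<le> F"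
    using dvd_F[of "2 * int N + 1"] \<open>F > 0\<close> by (simp add: zdvd_imp_le)
  moreover have "F * 1 \<le> F * F" using \<open>F > 0\<close> by (intro mult_left_mono) auto
  ultimately have "L > int N" unfolding L_def by linarith
  have d: "0 < d s" "d s \<le> L" "d s * b s = L" if "\<bar>s\<bar> \<le> int N" for s
  proof -
    have "s \<noteq> 0 \<Longrightarrow> \<bar>s\<bar> dvd L"
      using dvd_F[of "\<bar>s\<bar>"] that unfolding L_def by (intro dvd_mult) auto
    then show "d s * b s = L" by (simp add: b_def d_def)
    show "0 < d s" using \<open>L > 0\<close> by (simp add: d_def)
    show "d s \<le> L" using that \<open>L > int N\<close> by (simp add: d_def)
  qed
  have b: "b s \<ge> 1" if "\<bar>s\<bar> \<le> int N" for s
  proof -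
    have "0 < d s * b s" using d[OF that] \<open>L > 0\<close> by simp
    then show ?thesis using d(1)[OF that] by (simp add: zero_less_mult_iff)
  qed
  have form: "d s * (- sgn s + b s * k) = L * k - s" if "\<bar>s\<bar> \<le> int N" for s k
  proof -
    have "d s * (- sgn s + b s * k) = (d s * b s) * k - d s * sgn s"
      by (simp add: algebra_simps)
    also have "d s * sgn s = s" by (simp add: d_def abs_mult_sgn)
    finally show ?thesis using d(3)[OF that] by simp
  qed
  have \<sigma>: "\<bar>\<sigma> i\<bar> \<le> int N" if "i \<in> {1..2 * N + 1}" for i
    using that by (auto simp: \<sigma>_def)
  have "\<not> (\<exists>n::int. n > 1 \<and> (\<forall>k. n dvd (\<Prod>i\<in>{1..2 * N + 1}. - sgn (\<sigma> i) + b (\<sigma> i) * k)))"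
  proof
    assume "\<exists>n::int. n > 1 \<and> (\<forall>k. n dvd (\<Prod>i\<in>{1..2 * N + 1}. - sgn (\<sigma> i) + b (\<sigma> i) * k))"
    then obtain n :: int where "n > 1"
      and n: "\<And>k. n dvd (\<Prod>i\<in>{1..2 * N + 1}. - sgn (\<sigma> i) + b (\<sigma> i) * k)" by blast
    obtain p where p: "prime p" "p dvd n"
      using \<open>n > 1\<close> prime_factor_int[of n] by auto
    have "p > 1" using p(1) by (rule prime_gt_1_int)
    have root: "\<exists>s. \<bar>s\<bar> \<le> int N \<and> p dvd - sgn s + b s * k" for k
    proof -
      have "p dvd (\<Prod>i\<in>{1..2 * N + 1}. - sgn (\<sigma> i) + b (\<sigma> i) * k)"
        using n p(2) dvd_trans by blast
      then show ?thesis using p(1) \<sigma> by (subst (asm) prime_dvd_prod_iff) blast+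
    qed
    show False
    proof (cases "p dvd L")
      case True
      then have "p dvd F" using p(1) by (simp add: L_def prime_dvd_mult_iff)
      \<comment> \<open>At \<open>k = 1\<close> the form for \<open>s = 0\<close> has the value 1,
        and modulo \<open>p\<close> all others reduce to \<open>- sgn s\<close>, a unit.\<close>
      obtain s where s: "\<bar>s\<bar> \<le> int N" "p dvd - sgn s + b s" using root[of 1] by auto
      show False
      proof (cases "s = 0")
        case True
        then have "b s = 1" using \<open>L > 0\<close> by (simp add: b_def d_def)
        then show False using s True \<open>p > 1\<close> by simp
      next
        case False
        then have "\<bar>s\<bar> dvd F" using dvd_F[of "\<bar>s\<bar>"] s by auto
        then have "b s = F * (F div \<bar>s\<bar>)"
          using False by (simp add: b_def d_def L_def div_mult_swap)
        then have "p dvd b s" using \<open>p dvd F\<close> by simp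
        then have "p dvd - sgn s" using s(2) dvd_add_left_iff by blast
        then show False using False \<open>p > 1\<close> by (auto simp: sgn_if split: if_splits)
      qed
    next
      case False
      \<comment> \<open>A prime up to \<open>2 * N + 1\<close> would divide \<open>F\<close>, hence
        \<open>L\<close>.\<close>
      then have "p > 2 * int N + 1"
        using dvd_F[of p] \<open>p > 1\<close> unfolding L_def by fastforce
      have "coprime p L" using p(1) False by (rule prime_imp_coprime)
      \<comment> \<open>Modulo \<open>p\<close>, \<open>v\<close> is the inverse of
        \<open>L\<close>. At \<open>k = v * (N + 1)\<close> the number \<open>L * k - s\<close> is
        congruent to \<open>N + 1 - s\<close>, which lies between 1 and \<open>2 * N + 1\<close> and
        so is no multiple of \<open>p\<close>.\<close>
      then obtain u v where uv: "u * p + v * L = 1"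
        using bezout_int[of p L] by (auto simp: coprime_iff_gcd_eq_1)
      obtain s where s: "\<bar>s\<bar> \<le> int N" "p dvd - sgn s + b s * (v * (int N + 1))"
        using root by blast
      have "p dvd L * (v * (int N + 1)) - s"
        using dvd_mult[OF s(2), of "d s"] unfolding form[OF s(1)] .
      moreover have "v * L = 1 - u * p" using uv by linarith
      then have "L * (v * (int N + 1)) = (1 - u * p) * (int N + 1)"
        by (metis mult.assoc mult.commute)
      then have "L * (v * (int N + 1)) - s = (int N + 1 - s) - p * (u * (int N + 1))"
        by (simp add: algebra_simps)
      ultimately have "p dvd (int N + 1 - s) - p * (u * (int N + 1))" by simp
      then have "p dvd (int N + 1 - s)" by (simp only: dvd_diff_left_iff dvd_triv_left)
      then have "p \<le> int N + 1 - s" using s(1) by (intro zdvd_imp_le) auto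
      then show False using s(1) \<open>p > 2 * int N + 1\<close> by linarith
    qed
  qed
  note no_fixed_divisor = this
  have "infinite {m::nat. \<forall>i\<in>{1..2 * N + 1}. prime (- sgn (\<sigma> i) + b (\<sigma> i) * int m)}"
  proof (rule assms[unfolded dickson_conjecture_def, THEN spec, THEN spec, THEN spec,
        THEN mp, THEN mp, THEN mp])
    show "\<forall>i\<in>{1..2 * N + 1}. b (\<sigma> i) \<ge> 1" using b \<sigma> by blast
  qed (use no_fixed_divisor in simp_all)
  \<comment> \<open>This size suffices for all \<open>s\<close> together: as
    \<open>b s \<ge> 1\<close>, each prime \<open>- sgn s + b s * m\<close> is at least
    \<open>m - 1\<close>, which exceeds \<open>N * L\<close> and thus
    \<open>N * d s\<close>.\<close>
  then obtain m :: nat where "m > nat (int N * L + 1)"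
    and m: "\<And>i. i \<in> {1..2 * N + 1} \<Longrightarrow> prime (- sgn (\<sigma> i) + b (\<sigma> i) * int m)"
    by (metis (mono_tags, lifting) finite_nat_set_iff_bounded_le mem_Collect_eq not_le)
  then have m_gt: "int m > int N * L + 1" by linarith
  have "int N * 1 \<le> int N * L" using \<open>L > 0\<close> by (intro mult_left_mono) auto
  show thesis
  proof
    show "L > int N" by fact
    show "int m > int N" using m_gt \<open>int N * 1 \<le> int N * L\<close> by linarith
    fix s :: int assume s: "\<bar>s\<bar> \<le> int N"
    let ?q = "- sgn s + b s * int m"
    have "nat (s + 1 + int N) \<in> {1..2 * N + 1}" and "\<sigma> (nat (s + 1 + int N)) = s"
      using s by (auto simp: \<sigma>_def)
    then have "prime ?q" using m by metis
    moreover have "1 * int m \<le> b s * int m" using b[OF s] by (intro mult_right_mono) auto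
    then have "?q > int N * L" using m_gt by (auto simp: sgn_if)
    moreover have "int N * d s \<le> int N * L" using d(2)[OF s] by (intro mult_left_mono) auto
    ultimately show "\<exists>d q. 0 < d \<and> prime q \<and> q > int N * d \<and> L * int m - s = d * q"
      using form[OF s, of "int m"] d(1)[OF s] by (intro exI[of _ "d s"] exI[of _ ?q]) auto
  qed
qed

section \<open>Ultrapowers of the integers\<close>

definition ultrafilter :: "'i filter \<Rightarrow> bool" where
  "ultrafilter U \<longleftrightarrow> U \<noteq> bot \<and> (\<forall>P. eventually P U \<or> eventually (\<lambda>n. \<not> P n) U)"

text \<open>Smaller filters are finer, so Zorn's lemma is applied to the reversed order. It yields a
  minimal proper filter below \<open>F\<close>, and minimality makes it decide every
  predicate.\<close>

lemma ultrafilter_exists: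
  assumes "F \<noteq> bot"
  obtains U where "U \<le> F" "ultrafilter U"
proof -
  let ?A = "{G. G \<noteq> bot \<and> G \<le> F}"
  let ?r = "\<lambda>G H :: 'a filter. H \<le> G"
  have "partial_order_on ?A (relation_of ?r ?A)"
    by (rule partial_order_on_relation_ofI) auto
  moreover have "\<exists>u\<in>?A. \<forall>a\<in>C. u \<le> a" if "C \<in> Chains (relation_of ?r ?A)" for C
  proof (cases "C = {}")
    case True
    then show ?thesis using assms by auto
  next
    case False
    have C: "\<And>G. G \<in> C \<Longrightarrow> G \<noteq> bot \<and> G \<le> F"
      and tot: "\<And>G H. G \<in> C \<Longrightarrow> H \<in> C \<Longrightarrow> H \<le> G \<or> G \<le> H"
      using that unfolding Chains_def relation_of_def by blast+
    have "\<exists>x\<in>C. x \<le> inf G H" if "G \<in> C" "H \<in> C" for G H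
      using tot[OF that] that by (metis inf.absorb1 inf.absorb2 order_refl)
    \<comment> \<open>A nonempty chain is a filter base, so its infimum could be improper only if
      one of its members were.\<close>
    then have "eventually (\<lambda>_. False) (Inf C) \<longleftrightarrow> (\<exists>G\<in>C. eventually (\<lambda>_. False) G)"
      by (rule eventually_Inf_base[OF False])
    then have "Inf C \<noteq> bot" using C by (auto simp: eventually_False)
    moreover have "Inf C \<le> F" using False C by (meson Inf_lower ex_in_conv order_trans)
    ultimately show ?thesis by (auto intro: Inf_lower)
  qed
  ultimately obtain U where "U \<noteq> bot" "U \<le> F"
    and U: "\<And>G. G \<noteq> bot \<Longrightarrow> G \<le> F \<Longrightarrow> G \<le> U \<Longrightarrow> G = U"
    using predicate_Zorn[of ?A ?r] by auto
  \<comment> \<open>Restrict \<open>U\<close> to the set where \<open>P\<close> holds. Either the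
    result is improper, and \<open>P\<close> fails eventually, or by minimality it is
    \<open>U\<close> itself.\<close>
  have "eventually P U \<or> eventually (\<lambda>n. \<not> P n) U" for P
  proof (cases "inf U (principal {n. P n}) = bot")
    case True
    then have "eventually (\<lambda>_. False) (inf U (principal {n. P n}))" by simp
    then show ?thesis by (simp add: eventually_inf_principal)
  next
    case False
    then have "inf U (principal {n. P n}) = U" using U \<open>U \<le> F\<close> by (simp add: le_infI1)
    moreover have "eventually P (inf U (principal {n. P n}))" by (simp add: eventually_inf_principal)
    ultimately show ?thesis by simp
  qed
  with \<open>U \<noteq> bot\<close> \<open>U \<le> F\<close> that show thesis unfolding ultrafilter_def by blast
qed

lemma ultrafilter_eventually_not:
  assumes "ultrafilter U"
  shows "eventually (\<lambda>n. \<not> P n) U \<longleftrightarrow> \<not> eventually P U"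
proof -
  have "eventually (\<lambda>_. False) U" if "eventually P U" "eventually (\<lambda>n. \<not> P n) U"
    using that by eventually_elim simp
  then show ?thesis using assms unfolding ultrafilter_def eventually_False by blast
qed

lemma ultrafilter_eventually_disj:
  assumes "ultrafilter U"
  shows "eventually (\<lambda>n. P n \<or> Q n) U \<longleftrightarrow> eventually P U \<or> eventually Q U"
  using ultrafilter_eventually_not[OF assms, of "\<lambda>n. P n \<or> Q n"]
    ultrafilter_eventually_not[OF assms, of P] ultrafilter_eventually_not[OF assms, of Q]
  by (simp add: eventually_conj_iff) blast

section \<open>The ultrapower and its operations on germs\<close>

definition germ :: "'i filter \<Rightarrow> ('i \<Rightarrow> int) \<Rightarrow> ('i \<Rightarrow> int) set" where
  "germ U f = {g. eventually (\<lambda>n. g n = f n) U}"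

text \<open>The operations of the record accept arbitrary sets, so they act on representatives
  picked by \<open>SOME\<close>. On germs the choice is immaterial, since two representatives agree
  eventually.\<close>

definition ultrapower :: "'i filter \<Rightarrow> ('i \<Rightarrow> int) set ordered_ring_struct" where
  "ultrapower U = \<lparr>carrier = range (germ U),
     mult = (\<lambda>A B. germ U (\<lambda>n. (SOME f. f \<in> A) n * (SOME g. g \<in> B) n)),
     one = germ U (\<lambda>_. 1), zero = germ U (\<lambda>_. 0),
     add = (\<lambda>A B. germ U (\<lambda>n. (SOME f. f \<in> A) n + (SOME g. g \<in> B) n)),
     lt = (\<lambda>A B. eventually (\<lambda>n. (SOME f. f \<in> A) n < (SOME g. g \<in> B) n) U)\<rparr>"

lemma germ_eq_iff: "germ U f = germ U g \<longleftrightarrow> eventually (\<lambda>n. f n = g n) U"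
proof
  assume "germ U f = germ U g"
  moreover have "f \<in> germ U f" by (simp add: germ_def)
  ultimately show "eventually (\<lambda>n. f n = g n) U" by (simp add: germ_def)
next
  assume "eventually (\<lambda>n. f n = g n) U"
  then have "eventually (\<lambda>n. h n = f n) U \<longleftrightarrow> eventually (\<lambda>n. h n = g n) U" for h
    by (auto elim: eventually_elim2)
  then show "germ U f = germ U g" by (simp add: germ_def)
qed

lemma eventually_germ_some: "eventually (\<lambda>n. (SOME g. g \<in> germ U f) n = f n) U"
proof -
  have "f \<in> germ U f" by (simp add: germ_def)
  then have "(SOME g. g \<in> germ U f) \<in> germ U f" by (rule someI[of "\<lambda>g. g \<in> germ U f"])
  then show ?thesis by (simp add: germ_def)
qed

lemma carrier_ultrapower: "carrier (ultrapower U) = range (germ U)"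
  by (simp add: ultrapower_def)

lemma one_ultrapower: "\<one>\<^bsub>ultrapower U\<^esub> = germ U (\<lambda>_. 1)"
  by (simp add: ultrapower_def)

lemma zero_ultrapower: "\<zero>\<^bsub>ultrapower U\<^esub> = germ U (\<lambda>_. 0)"
  by (simp add: ultrapower_def)

lemma mult_ultrapower: "germ U f \<otimes>\<^bsub>ultrapower U\<^esub> germ U g = germ U (\<lambda>n. f n * g n)"
proof -
  have "eventually (\<lambda>n. (SOME h. h \<in> germ U f) n * (SOME h. h \<in> germ U g) n = f n * g n) U"
    using eventually_germ_some[of U f] eventually_germ_some[of U g]
    by eventually_elim simp
  then show ?thesis by (simp add: ultrapower_def germ_eq_iff)
qed

lemma add_ultrapower: "germ U f \<oplus>\<^bsub>ultrapower U\<^esub> germ U g = germ U (\<lambda>n. f n + g n)"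
proof -
  have "eventually (\<lambda>n. (SOME h. h \<in> germ U f) n + (SOME h. h \<in> germ U g) n = f n + g n) U"
    using eventually_germ_some[of U f] eventually_germ_some[of U g]
    by eventually_elim simp
  then show ?thesis by (simp add: ultrapower_def germ_eq_iff)
qed

lemma lt_ultrapower:
  "germ U f \<prec>\<^bsub>ultrapower U\<^esub> germ U g \<longleftrightarrow> eventually (\<lambda>n. f n < g n) U"
proof -
  have "eventually (\<lambda>n. (SOME h. h \<in> germ U f) n < (SOME h. h \<in> germ U g) n \<longleftrightarrow> f n < g n) U"
    using eventually_germ_some[of U f] eventually_germ_some[of U g]
    by eventually_elim simp
  then have "eventually (\<lambda>n. (SOME h. h \<in> germ U f) n < (SOME h. h \<in> germ U g) n) U
      \<longleftrightarrow> eventually (\<lambda>n. f n < g n) U"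
    by (rule eventually_subst)
  then show ?thesis by (simp add: ultrapower_def)
qed

lemmas ultrapower_simps = carrier_ultrapower one_ultrapower zero_ultrapower mult_ultrapower
  add_ultrapower lt_ultrapower germ_eq_iff

text \<open>Needed for \<open>absval\<close>. The inverse is a definite description, so uniqueness
  has to be checked too; it follows from pointwise arithmetic of integers on a set in the
  filter.\<close>

lemma a_inv_ultrapower: "\<ominus>\<^bsub>ultrapower U\<^esub> germ U f = germ U (\<lambda>n. - f n)"
  unfolding a_inv_def m_inv_def
proof (rule the_equality)
  show "germ U (\<lambda>n. - f n) \<in> carrier (add_monoid (ultrapower U)) \<and>
    germ U f \<otimes>\<^bsub>add_monoid (ultrapower U)\<^esub> germ U (\<lambda>n. - f n) = \<one>\<^bsub>add_monoid (ultrapower U)\<^esub> \<and>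
    germ U (\<lambda>n. - f n) \<otimes>\<^bsub>add_monoid (ultrapower U)\<^esub> germ U f = \<one>\<^bsub>add_monoid (ultrapower U)\<^esub>"
    by (simp add: ultrapower_simps rangeI)
next
  fix y
  assume "y \<in> carrier (add_monoid (ultrapower U)) \<and>
    germ U f \<otimes>\<^bsub>add_monoid (ultrapower U)\<^esub> y = \<one>\<^bsub>add_monoid (ultrapower U)\<^esub> \<and>
    y \<otimes>\<^bsub>add_monoid (ultrapower U)\<^esub> germ U f = \<one>\<^bsub>add_monoid (ultrapower U)\<^esub>"
  then obtain g where "y = germ U g" and "germ U f \<oplus>\<^bsub>ultrapower U\<^esub> y = \<zero>\<^bsub>ultrapower U\<^esub>"
    by (auto simp: carrier_ultrapower)
  moreover from this have "eventually (\<lambda>n. f n + g n = 0) U"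
    by (simp add: ultrapower_simps)
  moreover from this have "eventually (\<lambda>n. g n = - f n) U"
    by eventually_elim simp
  ultimately show "y = germ U (\<lambda>n. - f n)" by (simp add: germ_eq_iff)
qed

lemma is_structure_ultrapower: "is_structure (ultrapower U)"
  by (auto simp: is_structure_def carrier_ultrapower one_ultrapower zero_ultrapower
      mult_ultrapower add_ultrapower)

section \<open>Los's theorem and elementarity\<close>

lemma tm_val_ultrapower:
  "tm_val (ultrapower U) (\<lambda>i. germ U (e i)) t = germ U (\<lambda>n. tm_val int_struct (\<lambda>i. e i n) t)"
  by (induction t) (simp_all add: ultrapower_simps int_struct_def)

text \<open>Negation is where the ultrafilter property enters. The quantifier is handled by choosing
  a value at each index, since every element of the carrier is the germ of a sequence.\<close>

lemma los_ultrapower: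
  assumes "ultrafilter U"
  shows "sat (ultrapower U) (\<lambda>i. germ U (e i)) p
    \<longleftrightarrow> eventually (\<lambda>n. sat int_struct (\<lambda>i. e i n) p) U"
proof (induction p arbitrary: e)
  case (Eq s t)
  then show ?case by (simp add: tm_val_ultrapower germ_eq_iff)
next
  case (Less s t)
  then show ?case by (simp add: tm_val_ultrapower lt_ultrapower int_struct_def)
next
  case (Neg p)
  then show ?case using assms by (simp add: ultrafilter_eventually_not)
next
  case (And p q)
  then show ?case by (simp add: eventually_conj_iff)
next
  case (All k p)
  let ?S = "\<lambda>n x. sat int_struct ((\<lambda>i. e i n)(k := x)) p"
  have upd: "(\<lambda>i. germ U (e i))(k := germ U f) = (\<lambda>i. germ U ((e(k := f)) i))"
    "(\<lambda>i. (e(k := f)) i n) = (\<lambda>i. e i n)(k := f n)" for f n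
    by (simp_all add: fun_eq_iff)
  have "sat (ultrapower U) (\<lambda>i. germ U (e i)) (All k p) \<longleftrightarrow> (\<forall>f. eventually (\<lambda>n. ?S n (f n)) U)"
    by (simp add: carrier_ultrapower upd All.IH del: fun_upd_apply)
  also have "\<dots> \<longleftrightarrow> eventually (\<lambda>n. \<forall>x. ?S n x) U"
  proof
    assume "\<forall>f. eventually (\<lambda>n. ?S n (f n)) U"
    \<comment> \<open>The chosen sequence takes a counterexample at every index that has one, so
      wherever \<open>?S\<close> holds along it there is none.\<close>
    then have "eventually (\<lambda>n. ?S n (SOME x. \<not> ?S n x)) U" by (rule spec)
    then show "eventually (\<lambda>n. \<forall>x. ?S n x) U"
      by eventually_elim (metis (mono_tags, lifting) someI)
  qed (auto elim: eventually_mono)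
  also have "\<dots> \<longleftrightarrow> eventually (\<lambda>n. sat int_struct (\<lambda>i. e i n) (All k p)) U"
    by (simp add: int_struct_def)
  finally show ?case .
qed

text \<open>Los's theorem for constant sequences: truth no longer depends on the index, and
  \<open>U\<close> is proper.\<close>

lemma elementary_extension_ultrapower:
  assumes "ultrafilter U"
  shows "elementary_extension_of_int (ultrapower U) (\<lambda>x. germ U (\<lambda>_. x))"
proof -
  have "sat int_struct e p \<longleftrightarrow> sat (ultrapower U) ((\<lambda>x. germ U (\<lambda>_. x)) \<circ> e) p" for e p
    using los_ultrapower[OF assms, of "\<lambda>i _. e i" p] assms
    by (simp add: comp_def ultrafilter_def eventually_const)
  then show ?thesis
    by (auto simp: elementary_extension_of_int_def elementary_embedding_def
        is_structure_ultrapower carrier_ultrapower)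
qed

section \<open>Order, size and magnitude of germs\<close>

lemma leq_ultrapower:
  assumes "ultrafilter U"
  shows "germ U f \<preceq>\<^bsub>ultrapower U\<^esub> germ U g \<longleftrightarrow> eventually (\<lambda>n. f n \<le> g n) U"
  using ultrafilter_eventually_disj[OF assms, of "\<lambda>n. f n < g n" "\<lambda>n. f n = g n"]
  by (simp add: leq_def lt_ultrapower germ_eq_iff le_less)

lemma absval_ultrapower:
  assumes "ultrafilter U"
  shows "absval (ultrapower U) (germ U f) = germ U (\<lambda>n. \<bar>f n\<bar>)"
proof (cases "eventually (\<lambda>n. f n < 0) U")
  case True
  then have "eventually (\<lambda>n. - f n = \<bar>f n\<bar>) U" by eventually_elim simp
  with True show ?thesis
    by (simp add: absval_def ultrapower_simps a_inv_ultrapower)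
next
  case False
  then have "eventually (\<lambda>n. \<not> f n < 0) U" by (simp add: ultrafilter_eventually_not[OF assms])
  then have "eventually (\<lambda>n. f n = \<bar>f n\<bar>) U" by eventually_elim simp
  with False show ?thesis
    by (simp add: absval_def ultrapower_simps)
qed

lemma limited_ultrapower:
  assumes "ultrafilter U"
  shows "limited (ultrapower U) (\<lambda>x. germ U (\<lambda>_. x)) (germ U f)
    \<longleftrightarrow> (\<exists>k. eventually (\<lambda>n. \<bar>f n\<bar> \<le> k) U)"
  by (simp add: limited_def carrier_ultrapower absval_ultrapower[OF assms] leq_ultrapower[OF assms])

text \<open>A filter below \<open>sequentially\<close> contains every tail of the naturals, and on a
  far enough tail \<open>f\<close> exceeds any fixed integer.\<close>

lemma unlimited_ultrapower:
  fixes f :: "nat \<Rightarrow> int"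
  assumes "ultrafilter U" and "U \<le> sequentially" and f: "\<And>n. f n > int n"
  shows "unlimited (ultrapower U) (\<lambda>x. germ U (\<lambda>_. x)) (germ U f)"
proof -
  have "\<not> eventually (\<lambda>n. \<bar>f n\<bar> \<le> k) U" for k
  proof
    assume "eventually (\<lambda>n. \<bar>f n\<bar> \<le> k) U"
    moreover have "eventually (\<lambda>n. n \<ge> nat k) U"
      using assms(2) eventually_ge_at_top by (rule filter_leD)
    ultimately have "eventually (\<lambda>_. False) U"
    proof eventually_elim
      case (elim n)
      then show False using f[of n] by linarith
    qed
    then show False using assms(1) by (simp add: ultrafilter_def)
  qed
  then show ?thesis
    by (simp add: unlimited_def limited_ultrapower[OF assms(1)] carrier_ultrapower)
qed

text \<open>The limited multiplier is the germ of a sequence \<open>h\<close> eventually bounded by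
  a single integer, which may replace \<open>h\<close> because the absolute values it multiplies are
  nonnegative.\<close>

lemma same_magnitude_ultrapower:
  assumes "ultrafilter U"
    and "same_magnitude (ultrapower U) (\<lambda>x. germ U (\<lambda>_. x)) (germ U f) (germ U g)"
  obtains k where "eventually (\<lambda>n. \<bar>f n\<bar> \<le> k * \<bar>g n\<bar> \<and> \<bar>g n\<bar> \<le> k * \<bar>f n\<bar>) U"
proof -
  obtain h k where "eventually (\<lambda>n. \<bar>h n\<bar> \<le> k) U"
    and "eventually (\<lambda>n. \<bar>f n\<bar> \<le> h n * \<bar>g n\<bar>) U" "eventually (\<lambda>n. \<bar>g n\<bar> \<le> h n * \<bar>f n\<bar>) U"
    using assms(2) unfolding same_magnitude_def limited_def
    by (auto simp: carrier_ultrapower absval_ultrapower[OF assms(1)] mult_ultrapower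
        leq_ultrapower[OF assms(1)])
  then have "eventually (\<lambda>n. \<bar>f n\<bar> \<le> k * \<bar>g n\<bar> \<and> \<bar>g n\<bar> \<le> k * \<bar>f n\<bar>) U"
  proof eventually_elim
    case (elim n)
    then have "h n \<le> k" by linarith
    then have "h n * \<bar>g n\<bar> \<le> k * \<bar>g n\<bar>" "h n * \<bar>f n\<bar> \<le> k * \<bar>f n\<bar>"
      by (simp_all add: mult_right_mono)
    with elim show ?case by linarith
  qed
  then show thesis by (rule that)
qed

section \<open>The counterexample in the ultrapower\<close>

theorem corollary1:
  assumes dickson_conjecture
  shows "\<exists>(Z' :: ext_elem ordered_ring_struct) (j :: int \<Rightarrow> ext_elem).
    elementary_extension_of_int Z' j \<and>
    (\<exists>\<omega>\<in>carrier Z'.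
      (\<exists>s \<omega>\<^sub>1 \<omega>\<^sub>2. limited Z' j s \<and> unlimited Z' j \<omega>\<^sub>1 \<and> unlimited Z' j \<omega>\<^sub>2 \<and>
         \<omega> = s \<oplus>\<^bsub>Z'\<^esub> \<omega>\<^sub>1 \<otimes>\<^bsub>Z'\<^esub> \<omega>\<^sub>2) \<and>
      \<not> (\<exists>s'. \<exists>\<omega>\<^sub>1'\<in>carrier Z'. \<exists>\<omega>\<^sub>2'\<in>carrier Z'. limited Z' j s' \<and>
         same_magnitude Z' j \<omega>\<^sub>1' \<omega>\<^sub>2' \<and> \<omega> = s' \<oplus>\<^bsub>Z'\<^esub> \<omega>\<^sub>1' \<otimes>\<^bsub>Z'\<^esub> \<omega>\<^sub>2'))"
proof -
  obtain U :: "nat filter" where U: "U \<le> sequentially" "ultrafilter U"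
    using ultrafilter_exists[of sequentially] by auto
  let ?Z = "ultrapower U" and ?j = "\<lambda>x. germ U (\<lambda>_. x)"
  have "\<forall>N. \<exists>L m. L > int N \<and> m > int N \<and> (\<forall>s. \<bar>s\<bar> \<le> int N \<longrightarrow>
      (\<exists>d q. 0 < d \<and> prime q \<and> q > int N * d \<and> L * m - s = d * q))"
    using dickson_shifted_prime_multiples[OF assms] by metis
  then obtain L m :: "nat \<Rightarrow> int" where Lm: "\<And>N. L N > int N" "\<And>N. m N > int N"
    "\<And>N s. \<bar>s\<bar> \<le> int N \<Longrightarrow> \<exists>d q. 0 < d \<and> prime q \<and> q > int N * d \<and> L N * m N - s = d * q"
    by metis
  let ?\<omega> = "germ U (\<lambda>N. L N * m N)"
  \<comment> \<open>The unlimited factorization of \<open>?\<omega>\<close> needs no shift, so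
    \<open>s\<close> is 0.\<close>
  have "limited ?Z ?j (germ U (\<lambda>_. 0))"
    by (auto simp: limited_ultrapower[OF U(2)] intro: exI[of _ 0])
  moreover have "unlimited ?Z ?j (germ U L)" "unlimited ?Z ?j (germ U m)"
    using U Lm by (auto intro: unlimited_ultrapower)
  moreover have "?\<omega> = germ U (\<lambda>_. 0) \<oplus>\<^bsub>?Z\<^esub> germ U L \<otimes>\<^bsub>?Z\<^esub> germ U m"
    by (simp add: ultrapower_simps)
  moreover have False
    if lim: "limited ?Z ?j s" and mem: "\<omega>1 \<in> carrier ?Z" "\<omega>2 \<in> carrier ?Z"
      and mag: "same_magnitude ?Z ?j \<omega>1 \<omega>2"
      and eq: "?\<omega> = s \<oplus>\<^bsub>?Z\<^esub> \<omega>1 \<otimes>\<^bsub>?Z\<^esub> \<omega>2" for s \<omega>1 \<omega>2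
  proof -
    obtain f x y where germs: "s = germ U f" "\<omega>1 = germ U x" "\<omega>2 = germ U y"
      using lim mem by (auto simp: limited_def carrier_ultrapower)
    obtain k where "eventually (\<lambda>N. \<bar>x N\<bar> \<le> k * \<bar>y N\<bar> \<and> \<bar>y N\<bar> \<le> k * \<bar>x N\<bar>) U"
      by (rule same_magnitude_ultrapower[OF U(2) mag[unfolded germs]])
    moreover obtain l where "eventually (\<lambda>N. \<bar>f N\<bar> \<le> l) U"
      using lim germs by (auto simp: limited_ultrapower[OF U(2)])
    moreover have "eventually (\<lambda>N. L N * m N = f N + x N * y N) U"
      using eq by (simp add: germs ultrapower_simps)
    \<comment> \<open>From this index on, \<open>N\<close> bounds both the shift \<open>f N\<close>
      and the ratio \<open>k\<close>. The properties of \<open>L N * m N\<close> then apply with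
      \<open>s = f N\<close> and forbid a factorization as balanced as that of \<open>x N\<close>
      and \<open>y N\<close>.\<close>
    moreover have "eventually (\<lambda>N. N \<ge> nat (max k l)) U"
      using U(1) eventually_ge_at_top by (rule filter_leD)
    ultimately have "eventually (\<lambda>_. False) U"
    proof eventually_elim
      case (elim N)
      then have "k \<le> int N" "\<bar>f N\<bar> \<le> int N" by linarith+
      then obtain d q where "0 < d" "prime q" "q > int N * d" "L N * m N - f N = d * q"
        using Lm(3) by blast
      then have "\<not> (\<bar>x N\<bar> \<le> int N * \<bar>y N\<bar> \<and> \<bar>y N\<bar> \<le> int N * \<bar>x N\<bar>)"
        using elim by (intro prime_multiple_factors_unbalanced[of q _ d]) auto
      moreover have "k * \<bar>y N\<bar> \<le> int N * \<bar>y N\<bar>" "k * \<bar>x N\<bar> \<le> int N * \<bar>x N\<bar>"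
        using \<open>k \<le> int N\<close> by (simp_all add: mult_right_mono)
      ultimately show False using elim by linarith
    qed
    then show False using U(2) by (simp add: ultrafilter_def)
  qed
  ultimately have "(\<exists>s \<omega>1 \<omega>2. limited ?Z ?j s \<and> unlimited ?Z ?j \<omega>1 \<and> unlimited ?Z ?j \<omega>2 \<and>
         ?\<omega> = s \<oplus>\<^bsub>?Z\<^esub> \<omega>1 \<otimes>\<^bsub>?Z\<^esub> \<omega>2) \<and>
      \<not> (\<exists>s. \<exists>\<omega>1\<in>carrier ?Z. \<exists>\<omega>2\<in>carrier ?Z. limited ?Z ?j s \<and>
         same_magnitude ?Z ?j \<omega>1 \<omega>2 \<and> ?\<omega> = s \<oplus>\<^bsub>?Z\<^esub> \<omega>1 \<otimes>\<^bsub>?Z\<^esub> \<omega>2)"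
    by blast
  moreover have "?\<omega> \<in> carrier ?Z" by (simp add: carrier_ultrapower)
  ultimately show ?thesis
    using elementary_extension_ultrapower[OF U(2)] by blast
qed

end
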